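(* Let $G=(\{1,\dots,n\},E)$ be a finite simple graph and define $$\vartheta^{\lambda}(G)=\max\Big\{1-\frac{\lambda_{\max}(X)}{\lambda_{\min}(X)}:\ X\in\mathbb{R}^{n\times n}\text{ symmetric},\ X_{ii}=0\ \forall i\in\{1,\dots,n\},\ X_{ij}=0\ \forall\{i,j\}\in E\Big\}.$$ Then $\vartheta^{\lambda}(G)=\vartheta(G)$, the Lovász theta number of $G$.
   Context: $\lambda_{\min}(X)$ and $\lambda_{\max}(X)$ are the smallest and largest eigenvalues of the real symmetric matrix $X$, with the convention $\lambda_{\max}(X)/\lambda_{\min}(X)=0$ if $\lambda_{\max}(X)=\lambda_{\min}(X)=0$. The Lovász theta number $\vartheta(G)$ is defined as the optimum value of $$\min\big\{t:\ \overline z_{ii}=t-1\ \forall i,\ \ \overline z_{ij}=-1\ \forall\{i,j\}\notin E\ (i\ne j),\ \ \overline Z\succeq 0\big\},$$ over $t\in\mathbb{R}$ and real symmetric $\overline Z=(\overline z_{ij})\in\mathbb{R}^{n\times n}$, where $\succeq0$ means positive semidefinite. *)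

theory Defs
  imports "HOL-Analysis.Analysis"
begin

text \<open>
  A finite simple graph on \<open>n\<close> vertices has as its vertex set a finite type \<open>'n\<close> with
  \<open>CARD('n) = n\<close> and is given by its set of edges; vectors and matrices are then
  \<open>real ^ 'n\<close> and \<open>real ^ 'n ^ 'n\<close>.
\<close>

definition simple_graph :: "'n::finite set set \<Rightarrow> bool"
  where "simple_graph E \<longleftrightarrow> (\<forall>e\<in>E. card e = 2)"

definition symmetric_matrix :: "real ^ 'n ^ 'n \<Rightarrow> bool"
  where "symmetric_matrix A \<longleftrightarrow> transpose A = A"

definition pos_semidef :: "real ^ 'n ^ 'n \<Rightarrow> bool"
  where "pos_semidef A \<longleftrightarrow> symmetric_matrix A \<and> (\<forall>x. 0 \<le> x \<bullet> (A *v x))"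

definition is_eigenvalue :: "real ^ 'n ^ 'n \<Rightarrow> real \<Rightarrow> bool"
  where "is_eigenvalue A k \<longleftrightarrow> (\<exists>v. v \<noteq> 0 \<and> A *v v = k *\<^sub>R v)"

text \<open>
  The set of eigenvalues is always finite, and it is nonempty for symmetric \<open>A\<close>. The two
  definitions below are used for symmetric matrices only.
\<close>

definition lambda_max :: "real ^ 'n ^ 'n \<Rightarrow> real"
  where "lambda_max A = Max {k. is_eigenvalue A k}"

definition lambda_min :: "real ^ 'n ^ 'n \<Rightarrow> real"
  where "lambda_min A = Min {k. is_eigenvalue A k}"

definition theta_feasible :: "'n::finite set set \<Rightarrow> real \<Rightarrow> real ^ 'n ^ 'n \<Rightarrow> bool"
  where "theta_feasible E t Z \<longleftrightarrow>
    pos_semidef Z \<and>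
    (\<forall>i. Z $ i $ i = t - 1) \<and>
    (\<forall>i j. i \<noteq> j \<and> {i, j} \<notin> E \<longrightarrow> Z $ i $ j = - 1)"

definition lovasz_theta :: "'n::finite set set \<Rightarrow> real"
  where "lovasz_theta E = Inf {t. \<exists>Z. theta_feasible E t Z}"

definition lambda_feasible :: "'n::finite set set \<Rightarrow> real ^ 'n ^ 'n \<Rightarrow> bool"
  where "lambda_feasible E X \<longleftrightarrow>
    symmetric_matrix X \<and>
    (\<forall>i. X $ i $ i = 0) \<and>
    (\<forall>i j. {i, j} \<in> E \<longrightarrow> X $ i $ j = 0)"

text \<open>
  For \<open>X = 0\<close> the value below is \<open>1\<close>, because \<open>0 / 0 = 0\<close> in HOL; this is the convention
  that the quotient of the extreme eigenvalues is \<open>0\<close> if both vanish. No other feasible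
  \<open>X\<close> leads to a division by \<open>0\<close>, as \<open>X\<close> has trace \<open>0\<close>.
\<close>

definition theta_lambda_values :: "'n::finite set set \<Rightarrow> real set"
  where "theta_lambda_values E = {1 - lambda_max X / lambda_min X | X. lambda_feasible E X}"

text \<open>
  The optimum values are written as \<open>Sup\<close> and \<open>Inf\<close>, which are defined whether or not
  they are attained; that they are a maximum and a minimum has to be stated separately.
\<close>

definition theta_lambda :: "'n::finite set set \<Rightarrow> real"
  where "theta_lambda E = Sup (theta_lambda_values E)"

end

theory Submission
  imports Defs
begin

text \<open>
  Given a feasible \<open>X \<noteq> 0\<close> with smallest eigenvalue \<open>m < 0\<close> and an eigenvector \<open>v\<close> for the
  largest one, the matrix with entries \<open>v\<^sub>i (X - m I)\<^sub>i\<^sub>j v\<^sub>j\<close> is positive semidefinite, and pairing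
  it with a feasible \<open>Z\<close> of value \<open>t\<close> yields \<open>0 \<le> - m (t - 1) - lambda_max X\<close>, up to the
  factor \<open>v \<bullet> v\<close>. Conversely, separation of convex sets produces an optimal solution \<open>B\<close> of the
  dual semidefinite program, and rescaling \<open>B\<close> to unit diagonal and subtracting \<open>I\<close> gives an
  \<open>X\<close> with \<open>lambda_min X \<ge> - 1\<close>, whose Rayleigh quotient at \<open>(sqrt B\<^sub>i\<^sub>i)\<^sub>i\<close> is at least
  \<open>lovasz_theta E - 1\<close>.
\<close>

section \<open>Positive semidefinite matrices\<close>

lemma inner_matrix_vector_mult:
  fixes A :: "real ^ 'n ^ 'm"
  shows "x \<bullet> (A *v y) = (\<Sum>i\<in>UNIV. \<Sum>j\<in>UNIV. x $ i * A $ i $ j * y $ j)"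
  by (simp add: inner_vec_def matrix_vector_mult_def sum_distrib_left mult.assoc)

lemma axis_inner_matrix_vector_mult_axis:
  fixes A :: "real ^ 'n ^ 'm"
  shows "axis i 1 \<bullet> (A *v axis j 1) = A $ i $ j"
  by (simp add: inner_axis' matrix_vector_mult_basis column_def)

lemma symmetric_matrix_iff: "symmetric_matrix A \<longleftrightarrow> (\<forall>i j. A $ i $ j = A $ j $ i)"
  by (auto simp: symmetric_matrix_def transpose_def vec_eq_iff)

lemma symmetric_matrix_inner:
  assumes "symmetric_matrix A"
  shows "x \<bullet> (A *v y) = y \<bullet> (A *v x)"
  by (metis assms dot_lmul_matrix inner_commute symmetric_matrix_def transpose_matrix_vector)

text \<open>The form at x + s y is a quadratic polynomial in s without negative values, so its
  discriminant is not positive. If the leading coefficient vanishes, the polynomial is affine and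
  hence constant.\<close>

lemma pos_semidef_Cauchy_Schwarz:
  assumes "pos_semidef A"
  shows "(x \<bullet> (A *v y))\<^sup>2 \<le> (x \<bullet> (A *v x)) * (y \<bullet> (A *v y))"
proof -
  define a b c where "a = x \<bullet> (A *v x)" and "b = x \<bullet> (A *v y)" and "c = y \<bullet> (A *v y)"
  have "y \<bullet> (A *v x) = b"
    using assms by (simp add: b_def pos_semidef_def symmetric_matrix_inner)
  then have "(x + s *\<^sub>R y) \<bullet> (A *v (x + s *\<^sub>R y)) = a + 2 * s * b + s\<^sup>2 * c" for s
    by (simp add: a_def b_def c_def algebra_simps inner_add_left inner_add_right power2_eq_square)
  then have nonneg: "0 \<le> a + 2 * s * b + s\<^sup>2 * c" for s
    using assms by (metis pos_semidef_def)
  have "0 \<le> c"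
    using assms by (simp add: c_def pos_semidef_def)
  have "b\<^sup>2 \<le> a * c"
  proof (cases "c = 0")
    case True
    have "b = 0"
    proof (rule ccontr)
      assume "b \<noteq> 0"
      \<comment> \<open>At this s the affine polynomial a + 2 s b equals -1.\<close>
      then show False
        using nonneg[of "- (a + 1) / (2 * b)"] True by (simp add: field_simps)
    qed
    then show ?thesis
      using True by simp
  next
    case False
    then have "0 < c"
      using \<open>0 \<le> c\<close> by simp
    \<comment> \<open>The polynomial is evaluated at its minimizer -b / c.\<close>
    moreover have "0 \<le> a - b\<^sup>2 / c"
      using nonneg[of "- b / c"] False by (simp add: field_simps power2_eq_square)
    ultimately show ?thesis
      by (simp add: field_simps)
  qed
  then show ?thesis
    by (simp add: a_def b_def c_def)
qed

lemma pos_semidef_diag_nonneg: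
  assumes "pos_semidef A"
  shows "0 \<le> A $ i $ i"
  using assms axis_inner_matrix_vector_mult_axis[of i A i]
  by (metis (no_types) pos_semidef_def)

lemma pos_semidef_entry_le:
  assumes "pos_semidef A"
  shows "(A $ i $ j)\<^sup>2 \<le> A $ i $ i * A $ j $ j"
  using pos_semidef_Cauchy_Schwarz[OF assms, of "axis i 1" "axis j 1"]
  by (simp add: axis_inner_matrix_vector_mult_axis)

lemma pos_semidef_zero_diag:
  assumes "pos_semidef A" and "A $ i $ i = 0"
  shows "A $ i $ j = 0" and "A $ j $ i = 0"
  using pos_semidef_entry_le[OF assms(1), of i j] pos_semidef_entry_le[OF assms(1), of j i]
  by (simp_all add: assms(2))

lemma pos_semidef_eq_0:
  assumes "pos_semidef A" and "\<And>i. A $ i $ i = 0"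
  shows "A = 0"
  using pos_semidef_zero_diag(1)[OF assms] by (simp add: vec_eq_iff)

text \<open>Cauchy-Schwarz for the vectors \<open>A *v x\<close> and \<open>x\<close> bounds the
  fourth power of the norm of \<open>A *v x\<close> by 0.\<close>

lemma pos_semidef_kernel:
  assumes "pos_semidef A" and "x \<bullet> (A *v x) = 0"
  shows "A *v x = 0"
proof -
  have "((A *v x) \<bullet> (A *v x))\<^sup>2 \<le> 0"
    using pos_semidef_Cauchy_Schwarz[OF assms(1), of "A *v x" x] assms(2) by simp
  then show ?thesis
    by simp
qed

text \<open>
  One step of a Cholesky factorization: subtracting a rank-one matrix clears row and column
  \<open>k\<close>, which gives an induction on the number of nonzero diagonal entries.
\<close>
lemma pos_semidef_sum_mult_nonneg:
  fixes A B :: "real ^ 'n ^ 'n"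
  assumes "pos_semidef A" and "pos_semidef B"
  shows "0 \<le> (\<Sum>i\<in>UNIV. \<Sum>j\<in>UNIV. A $ i $ j * B $ i $ j)"
  using assms(1)
proof (induction "card {i. A $ i $ i \<noteq> 0}" arbitrary: A rule: less_induct)
  case less
  show ?case
  proof (cases "\<forall>i. A $ i $ i = 0")
    case True
    then show ?thesis
      using pos_semidef_eq_0[OF less.prems] by simp
  next
    case False
    then obtain k where k: "A $ k $ k \<noteq> 0"
      by blast
    then have pos: "0 < A $ k $ k"
      using pos_semidef_diag_nonneg[OF less.prems, of k] by simp
    have sym: "A $ i $ j = A $ j $ i" for i j
      using less.prems by (simp add: pos_semidef_def symmetric_matrix_iff)
    define c where "c = (\<chi> i. A $ i $ k)"
    \<comment> \<open>This is the Schur complement of the entry at (k, k). Its form is that of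
      \<open>A\<close> minus a square, and Cauchy-Schwarz against the k-th unit vector says that the
      difference is nonnegative.\<close>
    define A' where "A' = (\<chi> i j. A $ i $ j - c $ i * c $ j / A $ k $ k)"
    have form: "x \<bullet> (A' *v x) = x \<bullet> (A *v x) - (x \<bullet> c)\<^sup>2 / A $ k $ k" for x
    proof -
      have "(x \<bullet> c)\<^sup>2 / A $ k $ k = (\<Sum>i\<in>UNIV. \<Sum>j\<in>UNIV. x $ i * (c $ i * c $ j / A $ k $ k) * x $ j)"
        unfolding power2_eq_square inner_vec_def sum_product sum_divide_distrib
        by (intro sum.cong refl) (simp add: mult_ac)
      then show ?thesis
        by (simp add: inner_matrix_vector_mult A'_def algebra_simps sum_subtractf)
    qed
    have psd: "pos_semidef A'"
      unfolding pos_semidef_def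
    proof
      show "symmetric_matrix A'"
        by (simp add: symmetric_matrix_iff A'_def sym mult.commute)
      show "\<forall>x. 0 \<le> x \<bullet> (A' *v x)"
      proof
        fix x
        have "A *v axis k 1 = c"
          by (simp add: matrix_vector_mult_basis column_def c_def)
        then have "(x \<bullet> c)\<^sup>2 \<le> x \<bullet> (A *v x) * A $ k $ k"
          using pos_semidef_Cauchy_Schwarz[OF less.prems, of x "axis k 1"]
          by (simp add: inner_axis' c_def)
        then show "0 \<le> x \<bullet> (A' *v x)"
          using pos by (simp add: form field_simps)
      qed
    qed
    \<comment> \<open>A zero diagonal entry forces its whole row and column to vanish, so the
      subtraction leaves it at zero, while entry k becomes zero.\<close>
    have "{i. A' $ i $ i \<noteq> 0} \<subset> {i. A $ i $ i \<noteq> 0}"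
    proof
      have "A' $ i $ i = 0" if "A $ i $ i = 0" for i
        using that pos_semidef_zero_diag[OF less.prems that] by (simp add: A'_def c_def)
      then show "{i. A' $ i $ i \<noteq> 0} \<subseteq> {i. A $ i $ i \<noteq> 0}"
        by blast
      have "A' $ k $ k = 0"
        using k by (simp add: A'_def c_def)
      then show "{i. A' $ i $ i \<noteq> 0} \<noteq> {i. A $ i $ i \<noteq> 0}"
        using k by blast
    qed
    then have "card {i. A' $ i $ i \<noteq> 0} < card {i. A $ i $ i \<noteq> 0}"
      by (simp add: psubset_card_mono)
    then have "0 \<le> (\<Sum>i\<in>UNIV. \<Sum>j\<in>UNIV. A' $ i $ j * B $ i $ j)"
      using less.hyps psd by blast
    moreover have "0 \<le> (c \<bullet> (B *v c)) / A $ k $ k"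
      using assms(2) pos by (simp add: pos_semidef_def)
    moreover have "(\<Sum>i\<in>UNIV. \<Sum>j\<in>UNIV. A $ i $ j * B $ i $ j)
      = (\<Sum>i\<in>UNIV. \<Sum>j\<in>UNIV. A' $ i $ j * B $ i $ j) + (c \<bullet> (B *v c)) / A $ k $ k"
      unfolding inner_matrix_vector_mult sum_divide_distrib sum.distrib[symmetric]
      by (intro sum.cong refl) (simp add: A'_def algebra_simps)
    ultimately show ?thesis
      by simp
  qed
qed

section \<open>Extreme eigenvalues\<close>

text \<open>Eigenvectors for distinct eigenvalues are orthogonal, hence independent, so the
  dimension bounds their number. Without finiteness, \<open>Max\<close> and \<open>Min\<close> would
  say nothing about the spectrum.\<close>

lemma finite_eigenvalues:
  fixes A :: "real ^ 'n ^ 'n"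
  assumes "symmetric_matrix A"
  shows "finite {k. is_eigenvalue A k}"
proof -
  define K where "K = {k. is_eigenvalue A k}"
  have "\<forall>k\<in>K. \<exists>v. v \<noteq> 0 \<and> A *v v = k *\<^sub>R v"
    by (simp add: K_def is_eigenvalue_def)
  then obtain f where f: "\<And>k. k \<in> K \<Longrightarrow> f k \<noteq> 0" "\<And>k. k \<in> K \<Longrightarrow> A *v f k = k *\<^sub>R f k"
    by metis
  have orth: "f k \<bullet> f l = 0" if "k \<in> K" "l \<in> K" "k \<noteq> l" for k l
  proof -
    have "k * (f k \<bullet> f l) = l * (f k \<bullet> f l)"
      using symmetric_matrix_inner[OF assms, of "f k" "f l"] f(2) that
      by (simp add: inner_commute)
    then show ?thesis
      using that by simp
  qed
  have "inj_on f K"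
    using orth f(1) by (metis inj_onI inner_eq_zero_iff)
  moreover have "finite (f ` K)"
  proof -
    have "pairwise orthogonal (f ` K)"
      unfolding pairwise_def orthogonal_def using orth by blast
    moreover have "0 \<notin> f ` K"
      using f(1) by force
    ultimately show ?thesis
      using pairwise_orthogonal_independent independent_bound by blast
  qed
  ultimately show ?thesis
    unfolding K_def by (simp add: finite_image_iff)
qed

text \<open>
  The maximum \<open>k\<close> of the Rayleigh quotient is an eigenvalue, because \<open>k I - A\<close> is positive
  semidefinite and its quadratic form vanishes at the maximizer.
\<close>
lemma exists_largest_eigenvalue:
  fixes A :: "real ^ 'n ^ 'n"
  assumes "symmetric_matrix A"
  shows "\<exists>k. is_eigenvalue A k \<and> (\<forall>x. x \<bullet> (A *v x) \<le> k * (x \<bullet> x))"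
proof -
  have "compact (sphere 0 1 :: (real ^ 'n) set)" "sphere 0 1 \<noteq> ({} :: (real ^ 'n) set)"
    by simp_all
  moreover have "continuous_on (sphere 0 1) (\<lambda>x. x \<bullet> (A *v x))"
    by (intro continuous_intros linear_continuous_on linear_conv_bounded_linear[THEN iffD1]) simp
  ultimately obtain u where u: "norm u = 1"
    and max: "\<And>x. norm x = 1 \<Longrightarrow> x \<bullet> (A *v x) \<le> u \<bullet> (A *v u)"
    using continuous_attains_sup[of "sphere 0 1" "\<lambda>x. x \<bullet> (A *v x)"] by auto
  define k where "k = u \<bullet> (A *v u)"
  have le: "x \<bullet> (A *v x) \<le> k * (x \<bullet> x)" for x
  proof (cases "x = 0")
    case False
    define y where "y = x /\<^sub>R norm x"
    have "norm y = 1" and x: "x = norm x *\<^sub>R y"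
      using False by (simp_all add: y_def)
    then have "(norm x)\<^sup>2 * (y \<bullet> (A *v y)) \<le> (norm x)\<^sup>2 * k"
      using max by (intro mult_left_mono) (simp_all add: k_def)
    moreover have "x \<bullet> (A *v x) = (norm x)\<^sup>2 * (y \<bullet> (A *v y))"
      by (subst (1 2) x) (simp add: matrix_vector_mult_scaleR power2_eq_square)
    ultimately show ?thesis
      by (simp add: dot_square_norm mult.commute)
  qed simp
  define M where "M = k *\<^sub>R mat 1 - A"
  have Mv: "M *v x = k *\<^sub>R x - A *v x" for x
    by (simp add: M_def algebra_simps flip: scaleR_matrix_vector_assoc)
  have "pos_semidef M"
    using assms le
    by (auto simp: pos_semidef_def Mv inner_diff_right symmetric_matrix_iff) (simp add: M_def mat_def)
  moreover have "u \<bullet> (M *v u) = 0"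
    using u by (simp add: Mv inner_diff_right k_def dot_square_norm)
  ultimately have "A *v u = k *\<^sub>R u"
    using pos_semidef_kernel Mv by (metis eq_iff_diff_eq_0)
  moreover have "u \<noteq> 0"
    using u by auto
  ultimately show ?thesis
    using le unfolding is_eigenvalue_def by blast
qed

lemma is_eigenvalue_le:
  assumes "is_eigenvalue A l" and "\<And>x. x \<bullet> (A *v x) \<le> k * (x \<bullet> x)"
  shows "l \<le> k"
  using assms unfolding is_eigenvalue_def
  by (metis inner_gt_zero_iff inner_scaleR_right mult_le_cancel_right_pos)

text \<open>An eigenvalue that bounds the Rayleigh quotient bounds every other eigenvalue, so it is
  the \<open>Max\<close> of the definition.\<close>

lemma lambda_max:
  fixes A :: "real ^ 'n ^ 'n"
  assumes "symmetric_matrix A"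
  shows "is_eigenvalue A (lambda_max A)" and "x \<bullet> (A *v x) \<le> lambda_max A * (x \<bullet> x)"
proof -
  obtain k where k: "is_eigenvalue A k" "\<And>x. x \<bullet> (A *v x) \<le> k * (x \<bullet> x)"
    using exists_largest_eigenvalue[OF assms] by blast
  have "lambda_max A = k"
    unfolding lambda_max_def using finite_eigenvalues[OF assms] k(1) is_eigenvalue_le[OF _ k(2)]
    by (intro Max_eqI) auto
  then show "is_eigenvalue A (lambda_max A)" "x \<bullet> (A *v x) \<le> lambda_max A * (x \<bullet> x)"
    using k by simp_all
qed

lemma matrix_vector_mult_uminus: "(- A) *v x = - (A *v x)"
  for A :: "real ^ 'n ^ 'm"
  by (simp add: vec_eq_iff matrix_vector_mult_def sum_negf)

lemma lambda_min_eq: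
  fixes A :: "real ^ 'n ^ 'n"
  assumes "symmetric_matrix A"
  shows "lambda_min A = - lambda_max (- A)"
proof -
  have "symmetric_matrix (- A)"
    using assms by (simp add: symmetric_matrix_iff)
  note max = lambda_max[OF this]
  have iff: "is_eigenvalue (- A) k \<longleftrightarrow> is_eigenvalue A (- k)" for k
    unfolding is_eigenvalue_def matrix_vector_mult_uminus
    by (metis (no_types) minus_minus scaleR_minus_left)
  have "- lambda_max (- A) \<le> l" if "is_eigenvalue A l" for l
    using is_eigenvalue_le[OF _ max(2), of "- l"] iff[of "- l"] that by simp
  then show ?thesis
    unfolding lambda_min_def using finite_eigenvalues[OF assms] max(1) iff
    by (intro Min_eqI) auto
qed

lemma lambda_min:
  fixes A :: "real ^ 'n ^ 'n"
  assumes "symmetric_matrix A"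
  shows "lambda_min A * (x \<bullet> x) \<le> x \<bullet> (A *v x)"
    and "(\<And>x. k * (x \<bullet> x) \<le> x \<bullet> (A *v x)) \<Longrightarrow> k \<le> lambda_min A"
proof -
  have "symmetric_matrix (- A)"
    using assms by (simp add: symmetric_matrix_iff)
  note max = lambda_max[OF this]
  show "lambda_min A * (x \<bullet> x) \<le> x \<bullet> (A *v x)"
    using max(2)[of x] by (simp add: lambda_min_eq[OF assms] matrix_vector_mult_uminus)
  assume "\<And>x. k * (x \<bullet> x) \<le> x \<bullet> (A *v x)"
  then show "k \<le> lambda_min A"
    using is_eigenvalue_le[OF max(1), of "- k"]
    by (simp add: lambda_min_eq[OF assms] matrix_vector_mult_uminus)
qed

text \<open>Otherwise the matrix would be positive semidefinite with zero diagonal, hence zero. This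
  fixes the sign of the denominator in the quotient of eigenvalues.\<close>

lemma lambda_min_zero_diag:
  fixes A :: "real ^ 'n ^ 'n"
  assumes "symmetric_matrix A" and "\<And>i. A $ i $ i = 0" and "A \<noteq> 0"
  shows "lambda_min A < 0"
proof (rule ccontr)
  assume "\<not> lambda_min A < 0"
  then have "0 \<le> x \<bullet> (A *v x)" for x
    using lambda_min(1)[OF assms(1), of x] by (smt (verit) inner_ge_zero mult_nonneg_nonneg)
  then have "pos_semidef A"
    using assms(1) by (simp add: pos_semidef_def)
  then show False
    using pos_semidef_eq_0 assms by blast
qed

section \<open>Weak duality\<close>

lemma theta_feasible_ge_1:
  assumes "theta_feasible E t Z"
  shows "1 \<le> t"
  using assms pos_semidef_diag_nonneg[of Z undefined] by (simp add: theta_feasible_def)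

lemma lambda_max_0: "lambda_max (0 :: real ^ 'n ^ 'n) = 0"
proof -
  have "is_eigenvalue (0 :: real ^ 'n ^ 'n) k \<longleftrightarrow> k = 0" for k
    unfolding is_eigenvalue_def by (auto intro: exI[of _ "axis undefined 1"] simp: axis_eq_0_iff)
  then show ?thesis
    by (simp add: lambda_max_def)
qed

lemma lambda_value_le:
  fixes E :: "'n::finite set set"
  assumes X: "lambda_feasible E X" and Z: "theta_feasible E t Z"
  shows "1 - lambda_max X / lambda_min X \<le> t"
proof (cases "X = 0")
  case True
  then show ?thesis
    using theta_feasible_ge_1[OF Z] by (simp add: lambda_max_0)
next
  case False
  define m where "m = lambda_min X"
  have sym: "symmetric_matrix X" and diag: "X $ i $ i = 0" and edge: "{i, j} \<in> E \<Longrightarrow> X $ i $ j = 0" for i j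
    using X by (auto simp: lambda_feasible_def)
  have "m < 0"
    unfolding m_def using sym diag False by (rule lambda_min_zero_diag)
  obtain v where v: "v \<noteq> 0" "X *v v = lambda_max X *\<^sub>R v"
    using lambda_max(1)[OF sym] by (auto simp: is_eigenvalue_def)
  \<comment> \<open>With D the diagonal matrix of \<open>v\<close>, this is D (X - m I) D; the
    vector \<open>y\<close> below is D x.\<close>
  define W where "W = (\<chi> i j. v $ i * (X $ i $ j - (if i = j then m else 0)) * v $ j)"
  have "pos_semidef W"
    unfolding pos_semidef_def
  proof
    show "symmetric_matrix W"
      using sym by (auto simp: symmetric_matrix_iff W_def)
    show "\<forall>x. 0 \<le> x \<bullet> (W *v x)"
    proof
      fix x
      define y where "y = (\<chi> i. x $ i * v $ i)"
      have "x \<bullet> (W *v x) = (\<Sum>i\<in>UNIV. \<Sum>j\<in>UNIV. y $ i * X $ i $ j * y $ j - (if i = j then m * (y $ i * y $ j) else 0))"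
        unfolding inner_matrix_vector_mult
        by (intro sum.cong refl) (simp add: W_def y_def algebra_simps)
      also have "\<dots> = y \<bullet> (X *v y) - m * (y \<bullet> y)"
        by (simp add: sum_subtractf inner_matrix_vector_mult) (simp add: inner_vec_def sum_distrib_left)
      finally show "0 \<le> x \<bullet> (W *v x)"
        using lambda_min(1)[OF sym, of y] by (simp add: m_def)
    qed
  qed
  moreover have "pos_semidef Z"
    using Z by (simp add: theta_feasible_def)
  ultimately have "0 \<le> (\<Sum>i\<in>UNIV. \<Sum>j\<in>UNIV. W $ i $ j * Z $ i $ j)"
    by (rule pos_semidef_sum_mult_nonneg)
  \<comment> \<open>Off the diagonal, either \<open>X\<close> vanishes on an edge or
    \<open>Z\<close> is -1 on a non-edge, so only the value t of \<open>Z\<close> remains.\<close>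
  also have "\<dots> = (\<Sum>i\<in>UNIV. \<Sum>j\<in>UNIV. (if i = j then - (m * (t - 1)) * (v $ i * v $ j) else 0) - v $ i * X $ i $ j * v $ j)"
  proof (intro sum.cong refl)
    fix i j
    show "W $ i $ j * Z $ i $ j = (if i = j then - (m * (t - 1)) * (v $ i * v $ j) else 0) - v $ i * X $ i $ j * v $ j"
    proof (cases "i = j")
      case True
      moreover have "Z $ j $ j = t - 1"
        using Z by (simp add: theta_feasible_def)
      ultimately show ?thesis
        by (simp add: W_def diag)
    next
      case False
      then have "{i, j} \<in> E \<or> Z $ i $ j = - 1"
        using Z by (auto simp: theta_feasible_def)
      then show ?thesis
        using False edge[of i j] by (auto simp: W_def)
    qed
  qed
  also have "\<dots> = - (m * (t - 1)) * (v \<bullet> v) - v \<bullet> (X *v v)"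
    by (simp add: sum_subtractf inner_matrix_vector_mult) (simp add: inner_vec_def sum_distrib_left sum_negf)
  also have "\<dots> = (- m * (t - 1) - lambda_max X) * (v \<bullet> v)"
    by (simp add: v(2) algebra_simps)
  finally have "lambda_max X \<le> - m * (t - 1)"
    using v(1) by (simp add: zero_le_mult_iff inner_gt_zero_iff) (smt (verit) inner_gt_zero_iff)
  then show ?thesis
    using \<open>m < 0\<close> by (simp add: m_def field_simps)
qed

section \<open>Attainment of the theta number\<close>

text \<open>With n vertices the matrix is n I - J, where J is the all-ones matrix; its form is
  nonnegative because the square of a sum is at most n times the sum of squares. It provides a
  cutoff for the minimization below.\<close>

lemma theta_feasible_CARD:
  fixes E :: "'n::finite set set"
  shows "theta_feasible E (real CARD('n)) (\<chi> i j. (if i = j then real CARD('n) else 0) - 1)"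
    (is "theta_feasible E _ ?Z")
proof -
  have "0 \<le> x \<bullet> (?Z *v x)" for x
  proof -
    have "x \<bullet> (?Z *v x) = (\<Sum>i\<in>UNIV. \<Sum>j\<in>UNIV. real CARD('n) * (if i = j then x $ i * x $ j else 0) - x $ i * x $ j)"
      unfolding inner_matrix_vector_mult by (intro sum.cong refl) (simp add: algebra_simps)
    also have "\<dots> = real CARD('n) * (\<Sum>i\<in>UNIV. (x $ i)\<^sup>2) - (\<Sum>i\<in>UNIV. x $ i)\<^sup>2"
      by (simp add: sum_subtractf sum_product power2_eq_square flip: sum_distrib_left)
    finally show ?thesis
      using sum_squared_le_sum_of_squares[of "\<lambda>i. x $ i" UNIV] by (simp add: mult.commute)
  qed
  then show ?thesis
    by (simp add: theta_feasible_def pos_semidef_def symmetric_matrix_iff)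
qed

lemma lovasz_theta_le:
  assumes "theta_feasible E t Z"
  shows "lovasz_theta E \<le> t"
proof -
  have "bdd_below {t. \<exists>Z. theta_feasible E t Z}"
    using theta_feasible_ge_1 by (auto intro!: bdd_belowI)
  then show ?thesis
    unfolding lovasz_theta_def using assms by (auto intro: cInf_lower)
qed

text \<open>A continuous function attains its minimum on a compact set. Cutting off at t = n gives
  boundedness, since the diagonal of a positive semidefinite matrix controls all its
  entries.\<close>

lemma lovasz_theta_attained:
  fixes E :: "'n::finite set set"
  shows "\<exists>Z. theta_feasible E (lovasz_theta E) Z"
proof -
  define N where "N = real CARD('n)"
  define k where "k = (undefined :: 'n)"
  \<comment> \<open>The variable t is eliminated: it is read off as \<open>Z $ k $ k + 1\<close> at
    one fixed vertex.\<close>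
  define S where "S = {Z :: real ^ 'n ^ 'n. pos_semidef Z \<and> (\<forall>i. Z $ i $ i = Z $ k $ k) \<and>
    (\<forall>i j. i \<noteq> j \<and> {i, j} \<notin> E \<longrightarrow> Z $ i $ j = - 1) \<and> Z $ k $ k \<le> N - 1}"
  have S_iff: "Z \<in> S \<longleftrightarrow> theta_feasible E (Z $ k $ k + 1) Z \<and> Z $ k $ k \<le> N - 1" for Z
    by (auto simp: S_def theta_feasible_def)
  have "closed S"
    unfolding S_def pos_semidef_def symmetric_matrix_iff inner_matrix_vector_mult
    by (intro closed_Collect_conj closed_Collect_all closed_Collect_imp closed_Collect_le
        closed_Collect_eq open_Collect_const continuous_intros)
  moreover have "bounded S"
  proof (rule boundedI)
    fix Z
    assume "Z \<in> S"
    then have psd: "pos_semidef Z" and diag: "Z $ i $ i = Z $ k $ k" and le: "Z $ k $ k \<le> N - 1" for i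
      by (simp_all add: S_def)
    have "(Z $ i $ j)\<^sup>2 \<le> (N - 1)\<^sup>2" for i j
    proof -
      have "(Z $ i $ j)\<^sup>2 \<le> (Z $ k $ k)\<^sup>2"
        using pos_semidef_entry_le[OF psd, of i j] diag by (metis power2_eq_square)
      also have "\<dots> \<le> (N - 1)\<^sup>2"
        using le pos_semidef_diag_nonneg[OF psd] by (rule power_mono)
      finally show ?thesis .
    qed
    then have "Z \<bullet> Z \<le> (\<Sum>i\<in>(UNIV :: 'n set). \<Sum>j\<in>(UNIV :: 'n set). (N - 1)\<^sup>2)"
      unfolding inner_vec_def inner_real_def power2_eq_square by (intro sum_mono)
    then show "norm Z \<le> sqrt (\<Sum>i\<in>(UNIV :: 'n set). \<Sum>j\<in>(UNIV :: 'n set). (N - 1)\<^sup>2)"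
      unfolding norm_eq_sqrt_inner by (rule real_sqrt_le_mono)
  qed
  ultimately have "compact S"
    by (simp add: compact_eq_bounded_closed)
  moreover obtain Z0 where "Z0 \<in> S"
  proof
    show "(\<chi> i j. (if i = j then N else 0) - 1) \<in> S"
      using theta_feasible_CARD[of E] unfolding S_iff N_def by simp
  qed
  moreover have "continuous_on S (\<lambda>Z. Z $ k $ k)"
    by (intro continuous_intros)
  ultimately obtain Z where Z: "Z \<in> S" and min: "\<And>Y. Y \<in> S \<Longrightarrow> Z $ k $ k \<le> Y $ k $ k"
    using continuous_attains_inf[of S "\<lambda>Z. Z $ k $ k"] by blast
  have "lovasz_theta E = Z $ k $ k + 1"
    unfolding lovasz_theta_def
  proof (rule cInf_eq_minimum)
    show "Z $ k $ k + 1 \<in> {t. \<exists>Z. theta_feasible E t Z}"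
      using Z S_iff by blast
    fix t
    assume "t \<in> {t. \<exists>Z. theta_feasible E t Z}"
    then obtain Y where Y: "theta_feasible E t Y"
      by blast
    then have t: "Y $ k $ k + 1 = t"
      by (simp add: theta_feasible_def)
    show "Z $ k $ k + 1 \<le> t"
    proof (cases "t \<le> N")
      case True
      then have "Y \<in> S"
        using Y t by (auto simp: S_iff)
      then show ?thesis
        using min t by fastforce
    next
      case False
      then show ?thesis
        using Z by (simp add: S_iff)
    qed
  qed
  then show ?thesis
    using Z S_iff by auto
qed

section \<open>Strong duality\<close>

lemma inner_matrix_outer:
  fixes A :: "real ^ 'n ^ 'm"
  shows "A \<bullet> (\<chi> i j. x $ i * y $ j) = x \<bullet> (A *v y)"
  unfolding inner_matrix_vector_mult by (simp add: inner_vec_def mult_ac)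

lemma inner_outer_matrix_vector_mult:
  fixes x :: "real ^ 'n"
  shows "y \<bullet> ((\<chi> i j. x $ i * x $ j) *v y) = (x \<bullet> y)\<^sup>2"
  unfolding inner_matrix_vector_mult by (simp add: power2_eq_square inner_vec_def sum_product mult_ac)

lemma single_entry_matrix_vector_mult:
  fixes x :: "real ^ 'n"
  shows "axis i (axis j 1) *v x = axis i (x $ j)"
proof -
  have "(axis i (axis j 1) *v x) $ k = axis i (x $ j) $ k" for k
    by (cases "k = i") (simp_all add: matrix_vector_mul_component inner_axis', simp add: axis_def)
  then show ?thesis
    by (simp add: vec_eq_iff)
qed

text \<open>
  The certificate separates the matrices \<open>t I - J + A\<close> with \<open>t < lovasz_theta E\<close> and \<open>A\<close>
  supported on the edges from the cone of all matrices with nonnegative quadratic form. Not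
  requiring symmetry of either set forces the separating functional to be symmetric.
\<close>
lemma lovasz_theta_dual:
  fixes E :: "'n::finite set set"
  assumes "simple_graph E"
  obtains B where "pos_semidef B" and "B \<noteq> 0" and "\<And>i j. {i, j} \<in> E \<Longrightarrow> B $ i $ j = 0"
    and "lovasz_theta E * (\<Sum>i\<in>UNIV. B $ i $ i) \<le> (\<Sum>i\<in>UNIV. \<Sum>j\<in>UNIV. B $ i $ j)"
proof -
  define L where "L = {M :: real ^ 'n ^ 'n. \<exists>t < lovasz_theta E. (\<forall>i. M $ i $ i = t - 1) \<and>
    (\<forall>i j. i \<noteq> j \<and> {i, j} \<notin> E \<longrightarrow> M $ i $ j = - 1)}"
  define K where "K = {M :: real ^ 'n ^ 'n. \<forall>x. 0 \<le> x \<bullet> (M *v x)}"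
  define M :: "real \<Rightarrow> real ^ 'n ^ 'n"
    where "M = (\<lambda>t. \<chi> i j. (if i = j then t else 0) - 1)"
  have M: "M t \<in> L" if "t < lovasz_theta E" for t
    using that by (auto simp: L_def M_def)
  have "convex L"
    unfolding convex_def
  proof (intro ballI allI impI)
    fix P Q :: "real ^ 'n ^ 'n" and u v :: real
    assume "P \<in> L" "Q \<in> L" and uv: "0 \<le> u" "0 \<le> v" "u + v = 1"
    from \<open>P \<in> L\<close> obtain s where s: "s < lovasz_theta E" "\<And>i. P $ i $ i = s - 1"
        "\<And>i j. i \<noteq> j \<and> {i, j} \<notin> E \<Longrightarrow> P $ i $ j = - 1"
      by (auto simp: L_def)
    from \<open>Q \<in> L\<close> obtain t where t: "t < lovasz_theta E" "\<And>i. Q $ i $ i = t - 1"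
        "\<And>i j. i \<noteq> j \<and> {i, j} \<notin> E \<Longrightarrow> Q $ i $ j = - 1"
      by (auto simp: L_def)
    have "u * s + v * t < lovasz_theta E"
      using convex_bound_lt[OF s(1) t(1) uv] .
    moreover have "u * (s - 1) + v * (t - 1) = u * s + v * t - 1" "- u - v = - 1"
      using uv(3) by (simp_all add: algebra_simps)
    ultimately show "u *\<^sub>R P + v *\<^sub>R Q \<in> L"
      unfolding L_def using s t by (intro CollectI exI[of _ "u * s + v * t"]) auto
  qed
  moreover have "convex K"
    unfolding convex_def K_def
    by (auto simp: matrix_vector_mult_add_rdistrib inner_add_right simp flip: scaleR_matrix_vector_assoc)
  moreover have "L \<noteq> {}"
    using M[of "lovasz_theta E - 1"] by auto
  moreover have "K \<noteq> {}"
    by (auto simp: K_def intro!: exI[of _ 0])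
  moreover have "L \<inter> K = {}"
  proof (rule ccontr)
    assume "L \<inter> K \<noteq> {}"
    then obtain P t where P: "\<And>x. 0 \<le> x \<bullet> (P *v x)" "t < lovasz_theta E"
        "\<And>i. P $ i $ i = t - 1" "\<And>i j. i \<noteq> j \<and> {i, j} \<notin> E \<Longrightarrow> P $ i $ j = - 1"
      by (auto simp: L_def K_def)
    \<comment> \<open>Symmetrizing keeps the quadratic form and the prescribed entries, so
      \<open>Z\<close> would be feasible with a value below the infimum.\<close>
    define Z where "Z = (1 / 2) *\<^sub>R (P + transpose P)"
    have "x \<bullet> (Z *v x) = x \<bullet> (P *v x)" for x
      by (simp add: Z_def matrix_vector_mult_add_rdistrib inner_add_right inner_commute dot_lmul_matrix
          flip: scaleR_matrix_vector_assoc)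
        (metis dot_lmul_matrix inner_commute field_sum_of_halves)
    then have "pos_semidef Z"
      using P(1) by (simp add: pos_semidef_def) (simp add: symmetric_matrix_iff Z_def transpose_def)
    moreover have "P $ j $ i = - 1" if "i \<noteq> j" "{i, j} \<notin> E" for i j
      using that P(4)[of j i] by (simp add: insert_commute)
    ultimately have "theta_feasible E t Z"
      using P(3,4) by (simp add: theta_feasible_def) (simp add: Z_def transpose_def)
    then show False
      using lovasz_theta_le P(2) by fastforce
  qed
  ultimately obtain B b where "B \<noteq> 0" and L: "\<And>P. P \<in> L \<Longrightarrow> B \<bullet> P \<le> b"
    and K: "\<And>P. P \<in> K \<Longrightarrow> b \<le> B \<bullet> P"
    using separating_hyperplane_sets[of L K] by blast
  have "b \<le> 0"
    using K[of 0] by (simp add: K_def)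
  have cone: "0 \<le> B \<bullet> P" if "P \<in> K" for P
  proof (rule ccontr)
    assume neg: "\<not> 0 \<le> B \<bullet> P"
    \<comment> \<open>\<open>K\<close> is closed under nonnegative scaling; this factor would push
      the functional down to b - 1, below its bound on \<open>K\<close>.\<close>
    define c where "c = (b - 1) / (B \<bullet> P)"
    have "0 \<le> c"
      using neg \<open>b \<le> 0\<close> by (simp add: c_def divide_nonpos_neg)
    then have "c *\<^sub>R P \<in> K"
      using that by (simp add: K_def flip: scaleR_matrix_vector_assoc)
    moreover have "B \<bullet> (c *\<^sub>R P) = b - 1"
      using neg by (simp add: c_def)
    ultimately show False
      using K by fastforce
  qed
  have "B $ j $ i \<le> B $ i $ j" for i j
  proof -
    \<comment> \<open>A skew-symmetric matrix has zero quadratic form and so lies in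
      \<open>K\<close>.\<close>
    have "axis i (axis j 1) - axis j (axis i 1) \<in> K"
      by (simp add: K_def matrix_vector_mult_diff_rdistrib single_entry_matrix_vector_mult
          inner_diff_right inner_axis mult.commute)
    from cone[OF this] show ?thesis
      by (simp add: inner_diff_right inner_axis)
  qed
  then have "symmetric_matrix B"
    by (simp add: symmetric_matrix_iff order_antisym)
  moreover have "0 \<le> x \<bullet> (B *v x)" for x
    using cone[of "\<chi> i j. x $ i * x $ j"]
    by (simp add: K_def inner_outer_matrix_vector_mult inner_matrix_outer)
  ultimately have psd: "pos_semidef B"
    by (simp add: pos_semidef_def)
  have edge: "B $ i $ j = 0" if "{i, j} \<in> E" for i j
  proof (rule ccontr)
    assume nz: "B $ i $ j \<noteq> 0"
    define P where "P = M (lovasz_theta E - 1)"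
    \<comment> \<open>The entry at an edge is free in \<open>L\<close>; changing it by this amount
      would raise the functional to b + 1, above its bound on \<open>L\<close>.\<close>
    define c where "c = (b + 1 - B \<bullet> P) / B $ i $ j"
    have "i \<noteq> j"
      using assms that by (auto simp: simple_graph_def)
    then have "P + c *\<^sub>R axis i (axis j 1) \<in> L"
      using that by (auto simp: L_def P_def M_def axis_def insert_commute
          intro!: exI[of _ "lovasz_theta E - 1"])
    from L[OF this] show False
      using nz by (simp add: inner_add_right inner_axis c_def)
  qed
  define T S where "T = (\<Sum>i\<in>UNIV. B $ i $ i)" and "S = (\<Sum>i\<in>UNIV. \<Sum>j\<in>UNIV. B $ i $ j)"
  have below: "t * T \<le> S" if "t < lovasz_theta E" for t
  proof -
    have "B \<bullet> M t = (\<Sum>i\<in>UNIV. \<Sum>j\<in>UNIV. t * (if i = j then B $ i $ j else 0) - B $ i $ j)"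
      unfolding inner_vec_def by (intro sum.cong refl) (simp add: M_def algebra_simps)
    also have "\<dots> = t * T - S"
      by (simp add: sum_subtractf T_def S_def flip: sum_distrib_left)
    finally show ?thesis
      using L[OF M[OF that]] \<open>b \<le> 0\<close> by simp
  qed
  have "0 \<le> T"
    unfolding T_def by (intro sum_nonneg pos_semidef_diag_nonneg psd)
  \<comment> \<open>The bound for all smaller t passes to the limit after division by the trace; if
    the trace is zero, any one such t suffices.\<close>
  have "lovasz_theta E * T \<le> S"
  proof (cases "T = 0")
    case True
    then show ?thesis
      using below[of "lovasz_theta E - 1"] by simp
  next
    case False
    then have "0 < T"
      using \<open>0 \<le> T\<close> by simp
    then have "t \<le> S / T" if "t < lovasz_theta E" for t
      using below[OF that] by (simp add: pos_le_divide_eq)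
    then have "lovasz_theta E \<le> S / T"
      by (rule dense_le)
    then show ?thesis
      using \<open>0 < T\<close> by (simp add: pos_le_divide_eq)
  qed
  then show ?thesis
    using that psd \<open>B \<noteq> 0\<close> edge by (simp add: T_def S_def)
qed

lemma lambda_value_ge:
  fixes B :: "real ^ 'n ^ 'n"
  assumes psd: "pos_semidef B" and "B \<noteq> 0"
    and edge: "\<And>i j. {i, j} \<in> E \<Longrightarrow> B $ i $ j = 0"
    and le: "t * (\<Sum>i\<in>UNIV. B $ i $ i) \<le> (\<Sum>i\<in>UNIV. \<Sum>j\<in>UNIV. B $ i $ j)"
  obtains X where "lambda_feasible E X" and "t \<le> 1 - lambda_max X / lambda_min X"
proof -
  define v where "v = (\<chi> i. sqrt (B $ i $ i))"
  \<comment> \<open>If \<open>v $ i = 0\<close>, then row and column \<open>i\<close> of \<open>B\<close> vanish, so the value \<open>0\<close> of the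
    undefined quotient is the right one.\<close>
  define X where "X = (\<chi> i j. if i = j then 0 else B $ i $ j / (v $ i * v $ j))"
  have vv: "v $ i * v $ i = B $ i $ i" for i
    by (simp add: v_def pos_semidef_diag_nonneg[OF psd])
  have v0: "v $ i = 0 \<longleftrightarrow> B $ i $ i = 0" for i
    by (simp add: v_def)
  have sym: "symmetric_matrix X"
    using psd by (simp add: pos_semidef_def symmetric_matrix_iff X_def mult.commute)
  have diag: "X $ i $ i = 0" for i
    by (simp add: X_def)
  have feasible: "lambda_feasible E X"
    using sym edge by (simp add: lambda_feasible_def X_def)
  have "- 1 * (y \<bullet> y) \<le> y \<bullet> (X *v y)" for y
  proof -
    \<comment> \<open>Undoing the scaling turns the form of \<open>X + I\<close> at \<open>y\<close>
      into that of \<open>B\<close> at \<open>z\<close>, except where the diagonal of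
      \<open>B\<close> vanishes. There \<open>r\<close> is 0, which is why its sum is only bounded
      by \<open>y \<bullet> y\<close>.\<close>
    define z where "z = (\<chi> i. y $ i / v $ i)"
    define r where "r = (\<lambda>i. if B $ i $ i = 0 then 0 else (y $ i)\<^sup>2)"
    have "z $ i * B $ i $ i * z $ i = r i" for i
      using v0[of i] by (simp add: z_def r_def power2_eq_square flip: vv)
    then have "y \<bullet> (X *v y) = (\<Sum>i\<in>UNIV. \<Sum>j\<in>UNIV. z $ i * B $ i $ j * z $ j - (if i = j then r i else 0))"
      unfolding inner_matrix_vector_mult by (intro sum.cong refl) (auto simp: X_def z_def)
    also have "\<dots> = z \<bullet> (B *v z) - (\<Sum>i\<in>UNIV. r i)"
      by (simp add: sum_subtractf inner_matrix_vector_mult)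
    finally have "y \<bullet> (X *v y) = z \<bullet> (B *v z) - (\<Sum>i\<in>UNIV. r i)" .
    moreover have "(\<Sum>i\<in>UNIV. r i) \<le> y \<bullet> y"
      unfolding inner_vec_def by (intro sum_mono) (simp add: r_def power2_eq_square)
    moreover have "0 \<le> z \<bullet> (B *v z)"
      using psd by (simp add: pos_semidef_def)
    ultimately show ?thesis
      by simp
  qed
  then have min: "- 1 \<le> lambda_min X"
    by (rule lambda_min(2)[OF sym])
  have norm_v: "v \<bullet> v = (\<Sum>i\<in>UNIV. B $ i $ i)"
    by (simp add: inner_vec_def vv)
  \<comment> \<open>At \<open>v\<close> the scaling cancels: the form of \<open>X\<close> becomes
    the sum of all entries of \<open>B\<close> minus its trace.\<close>
  have "v $ i * X $ i $ j * v $ j = B $ i $ j - (if i = j then B $ i $ j else 0)" for i j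
  proof (cases "v $ i = 0 \<or> v $ j = 0")
    case True
    then have "B $ i $ j = 0"
      using v0 pos_semidef_zero_diag[OF psd, of i j] pos_semidef_zero_diag[OF psd, of j i] by blast
    then show ?thesis
      by (auto simp: X_def)
  qed (simp add: X_def)
  then have "v \<bullet> (X *v v) = (\<Sum>i\<in>UNIV. \<Sum>j\<in>UNIV. B $ i $ j) - v \<bullet> v"
    by (simp add: inner_matrix_vector_mult sum_subtractf norm_v)
  then have "(t - 1) * (v \<bullet> v) \<le> v \<bullet> (X *v v)"
    using le norm_v by (simp add: algebra_simps)
  also have "\<dots> \<le> lambda_max X * (v \<bullet> v)"
    by (rule lambda_max(2)[OF sym])
  finally have "(t - 1) * (v \<bullet> v) \<le> lambda_max X * (v \<bullet> v)" .
  moreover have "v \<noteq> 0"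
    using pos_semidef_eq_0[OF psd] \<open>B \<noteq> 0\<close> v0 by (metis zero_index)
  ultimately have max: "t - 1 \<le> lambda_max X"
    by simp
  have "t \<le> 1 - lambda_max X / lambda_min X"
  proof (cases "X = 0")
    case True
    then show ?thesis
      using max by (simp add: lambda_max_0)
  next
    case False
    have "0 \<le> lambda_max X"
      using lambda_max(2)[OF sym, of "axis undefined 1"]
      by (simp add: axis_inner_matrix_vector_mult_axis diag inner_axis_axis)
    \<comment> \<open>As \<open>lambda_min X\<close> lies in [-1, 0), dividing the nonnegative
      \<open>lambda_max X\<close> by its absolute value cannot decrease it.\<close>
    then have "0 \<le> lambda_max X * (1 + lambda_min X)"
      using min by simp
    then have "lambda_max X \<le> - lambda_max X / lambda_min X"
      using lambda_min_zero_diag[OF sym diag False] by (simp add: field_simps)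
    then show ?thesis
      using max by simp
  qed
  then show ?thesis
    using that feasible by blast
qed

theorem theorem2:
  fixes E :: "'n::finite set set"
  assumes "simple_graph E"
  shows "theta_lambda E \<in> theta_lambda_values E \<and>
         (\<forall>v \<in> theta_lambda_values E. v \<le> theta_lambda E) \<and>
         (\<exists>Z. theta_feasible E (lovasz_theta E) Z) \<and>
         (\<forall>t Z. theta_feasible E t Z \<longrightarrow> lovasz_theta E \<le> t) \<and>
         theta_lambda E = lovasz_theta E"
proof -
  obtain Z where Z: "theta_feasible E (lovasz_theta E) Z"
    using lovasz_theta_attained by blast
  have upper: "v \<le> lovasz_theta E" if "v \<in> theta_lambda_values E" for v
    using that lambda_value_le[OF _ Z] by (auto simp: theta_lambda_values_def)
  obtain B where "pos_semidef B" "B \<noteq> 0" "\<And>i j. {i, j} \<in> E \<Longrightarrow> B $ i $ j = 0"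
    "lovasz_theta E * (\<Sum>i\<in>UNIV. B $ i $ i) \<le> (\<Sum>i\<in>UNIV. \<Sum>j\<in>UNIV. B $ i $ j)"
    using lovasz_theta_dual[OF assms] by blast
  then obtain X where X: "lambda_feasible E X" "lovasz_theta E \<le> 1 - lambda_max X / lambda_min X"
    by (rule lambda_value_ge)
  then have "lovasz_theta E = 1 - lambda_max X / lambda_min X"
    using lambda_value_le[OF _ Z] by (simp add: order_antisym)
  then have attained: "lovasz_theta E \<in> theta_lambda_values E"
    using X(1) by (auto simp: theta_lambda_values_def)
  then have "theta_lambda E = lovasz_theta E"
    unfolding theta_lambda_def using upper by (rule cSup_eq_maximum)
  then show ?thesis
    using attained upper Z lovasz_theta_le by auto
qed

end
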